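(* Let $G$ be a semi-regular bipartite graph with positive integer parameters $n_1,n_2,r_1,r_2$, with $n_1\ge n_2$, and let $n=n_1+n_2$ and $\alpha\in[0,1)$. Then $$P_{A_\alpha(l(G))}(\lambda)=(1-\alpha)^{\gamma}\bigl(\lambda-\alpha(r_1+r_2)+2\bigr)^{\beta}P_{A(G)}\bigl(\sqrt{\alpha_1\alpha_2}\bigr)\sqrt{\left(\frac{\alpha_1}{\alpha_2}\right)^{n_1-n_2}},$$ where $\alpha_1=\frac{\lambda-\alpha r_2-r_1+2}{1-\alpha}$, $\alpha_2=\frac{\lambda-\alpha r_1-r_2+2}{1-\alpha}$, $\beta=n_1r_1-n$ and $\gamma=\frac{n_2r_2-n_1r_1+2n}{2}$.
   Context: A graph $G$ is semi-regular bipartite with parameters $(n_1,n_2,r_1,r_2)$ if it is bipartite with vertex classes $V_1,V_2$, $|V_1|=n_1$, $|V_2|=n_2$, every vertex of $V_1$ has degree $r_1$ and every vertex of $V_2$ has degree $r_2$ (so $n_1r_1=n_2r_2$). For a simple graph $G$ with adjacency matrix $A(G)$ and diagonal degree matrix $D(G)$, $A_\alpha(G)=\alpha D(G)+(1-\alpha)A(G)$. For a square matrix $M$ of order $k$, $P_M(\lambda)=\det(\lambda I_k-M)$. The line graph $l(G)$ has the edges of $G$ as vertices, two being adjacent iff the corresponding edges share an endpoint.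
   Formalization: The square roots are real and nonnegative when α₁≥0, α₂>0; for other (complex) λ their signs must be chosen so that √(α₁α₂)^(n₁−n₂) times the last root equals α₁^(n₁−n₂), as otherwise the formula can fail by a sign; λ where the right side is undefined are excluded. *)

theory Defs
  imports Complex_Main "Jordan_Normal_Form.Char_Poly"
begin

text \<open>A graph is a pair of a vertex set and a set of two-element edges.\<close>

type_synonym 'a ugraph = "'a set \<times> 'a set set"

abbreviation ugraph_verts :: "'a ugraph \<Rightarrow> 'a set" where
  "ugraph_verts G \<equiv> fst G"

abbreviation ugraph_edges :: "'a ugraph \<Rightarrow> 'a set set" where
  "ugraph_edges G \<equiv> snd G"

definition simple_graph :: "'a ugraph \<Rightarrow> bool" where
  "simple_graph G \<longleftrightarrow> finite (ugraph_verts G)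
     \<and> (\<forall>e\<in>ugraph_edges G. e \<subseteq> ugraph_verts G \<and> card e = 2)"

definition vertex_degree :: "'a ugraph \<Rightarrow> 'a \<Rightarrow> nat" where
  "vertex_degree G v = card {e \<in> ugraph_edges G. v \<in> e}"

definition semiregular_bipartite :: "'a ugraph \<Rightarrow> nat \<Rightarrow> nat \<Rightarrow> nat \<Rightarrow> nat \<Rightarrow> bool" where
  "semiregular_bipartite G n1 n2 r1 r2 \<longleftrightarrow> simple_graph G
     \<and> (\<exists>V1 V2. ugraph_verts G = V1 \<union> V2 \<and> V1 \<inter> V2 = {}
          \<and> (\<forall>e\<in>ugraph_edges G. \<exists>u\<in>V1. \<exists>v\<in>V2. e = {u, v})
          \<and> card V1 = n1 \<and> card V2 = n2
          \<and> (\<forall>v\<in>V1. vertex_degree G v = r1)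
          \<and> (\<forall>v\<in>V2. vertex_degree G v = r2))"

definition line_graph :: "'a ugraph \<Rightarrow> 'a set ugraph" where
  "line_graph G = (ugraph_edges G,
     {{e, f} | e f. e \<in> ugraph_edges G \<and> f \<in> ugraph_edges G \<and> e \<noteq> f \<and> e \<inter> f \<noteq> {}})"

text \<open>Rows and columns of the matrices of a graph are numbered by a list \<open>vs\<close>
  that enumerates its vertices.\<close>

definition vertex_enum :: "'a ugraph \<Rightarrow> 'a list \<Rightarrow> bool" where
  "vertex_enum G vs \<longleftrightarrow> distinct vs \<and> set vs = ugraph_verts G"

definition adjacency_matrix :: "'a ugraph \<Rightarrow> 'a list \<Rightarrow> real mat" where
  "adjacency_matrix G vs = mat (length vs) (length vs)
     (\<lambda>(i, j). if {vs ! i, vs ! j} \<in> ugraph_edges G then 1 else 0)"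

definition degree_matrix :: "'a ugraph \<Rightarrow> 'a list \<Rightarrow> real mat" where
  "degree_matrix G vs = mat (length vs) (length vs)
     (\<lambda>(i, j). if i = j then real (vertex_degree G (vs ! i)) else 0)"

definition A_alpha :: "real \<Rightarrow> 'a ugraph \<Rightarrow> 'a list \<Rightarrow> real mat" where
  "A_alpha \<alpha> G vs = \<alpha> \<cdot>\<^sub>m degree_matrix G vs + (1 - \<alpha>) \<cdot>\<^sub>m adjacency_matrix G vs"

text \<open>\<open>P\<^sub>M(x)\<close> for a real matrix \<open>M\<close> and a real argument, respectively a complex argument.\<close>

abbreviation charfun :: "real mat \<Rightarrow> real \<Rightarrow> real" where
  "charfun M x \<equiv> poly (char_poly M) x"

abbreviation ccharfun :: "real mat \<Rightarrow> complex \<Rightarrow> complex" where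
  "ccharfun M z \<equiv> poly (char_poly (map_mat complex_of_real M)) z"

lemma poly_char_poly_eq_det:
  fixes M :: "'a :: field mat"
  assumes M: "M \<in> carrier_mat k k"
  shows "poly (char_poly M) x = det (x \<cdot>\<^sub>m 1\<^sub>m k - M)"
proof -
  have "- char_matrix M x = x \<cdot>\<^sub>m 1\<^sub>m k - M"
    using M by (intro eq_matI) (auto simp: char_matrix_def)
  then show ?thesis
    using char_poly_matrix[OF M, of x] by simp
qed

end

theory Submission
  imports Defs
begin

text \<open>
  With \<open>B\<close> the vertex-edge incidence matrix of \<open>G\<close>, \<open>B\<^sup>TB = A(l(G)) + 2I\<close> and \<open>BB\<^sup>T = D(G) + A(G)\<close>,
  and every edge has degree \<open>r\<^sub>1 + r\<^sub>2 - 2\<close> in \<open>l(G)\<close>. Hence \<open>A\<^sub>\<alpha>(l(G))\<close> is an affine function of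
  \<open>B\<^sup>TB\<close>, and exchanging \<open>B\<^sup>TB\<close> for \<open>BB\<^sup>T\<close> in the characteristic polynomial leaves the determinant
  of \<open>diag(\<alpha>\<^sub>1, \<alpha>\<^sub>2) - A(G)\<close>, with \<open>\<alpha>\<^sub>1\<close> on the first vertex class and \<open>\<alpha>\<^sub>2\<close> on the second.
  Since \<open>A(G)\<close> is bipartite, scaling the rows and columns of the second class moves a factor \<open>u\<close>
  from one diagonal block to the other at the price of \<open>u\<^bsup>n\<^sub>1-n\<^sub>2\<^esup>\<close>, so the diagonals \<open>(\<alpha>\<^sub>1, \<alpha>\<^sub>2)\<close> and
  \<open>(s, s)\<close> with \<open>s\<^sup>2 = \<alpha>\<^sub>1\<alpha>\<^sub>2\<close> can both be compared with \<open>(1, \<alpha>\<^sub>1\<alpha>\<^sub>2)\<close>.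
\<close>

section \<open>Determinant identities\<close>

text \<open>Every term of the Leibniz expansion takes exactly one entry from each row and each
  column, so each term picks up all the factors \<open>e i\<close> and, after reindexing by the
  permutation, all the factors \<open>f j\<close>.\<close>

lemma det_scale_rows_cols:
  fixes A :: "'a :: comm_ring_1 mat"
  assumes A: "A \<in> carrier_mat n n"
  shows "det (mat n n (\<lambda>(i, j). e i * A $$ (i, j) * f j)) = (\<Prod>i<n. e i) * (\<Prod>j<n. f j) * det A"
proof -
  let ?B = "mat n n (\<lambda>(i, j). e i * A $$ (i, j) * f j)"
  have "signof p * (\<Prod>i = 0..<n. ?B $$ (i, p i))
      = (\<Prod>i<n. e i) * (\<Prod>j<n. f j) * (signof p * (\<Prod>i = 0..<n. A $$ (i, p i)))"
    if p: "p permutes {0..<n}" for p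
  proof -
    have lt: "p i < n" if "i < n" for i
      using permutes_in_image[OF p, of i] that by auto
    have "(\<Prod>i = 0..<n. ?B $$ (i, p i)) = (\<Prod>i = 0..<n. e i * A $$ (i, p i) * f (p i))"
      using lt by (intro prod.cong) auto
    also have "\<dots> = (\<Prod>i = 0..<n. e i) * (\<Prod>i = 0..<n. A $$ (i, p i)) * (\<Prod>i = 0..<n. f (p i))"
      by (simp add: prod.distrib)
    also have "(\<Prod>i = 0..<n. f (p i)) = (\<Prod>i = 0..<n. f i)"
      using prod.permute[OF p, of f] by (simp add: o_def)
    finally show ?thesis
      by (simp add: lessThan_atLeast0 ac_simps)
  qed
  then have "det ?B = (\<Sum>p | p permutes {0..<n}.
      (\<Prod>i<n. e i) * (\<Prod>j<n. f j) * (signof p * (\<Prod>i = 0..<n. A $$ (i, p i))))"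
    by (subst det_def'[of _ n]) (simp, intro sum.cong, auto)
  then show ?thesis
    using A by (simp only: det_def' flip: sum_distrib_left)
qed

text \<open>Block elimination: multiplying \<open>?M\<close> on the right by \<open>?L\<close>, of
  determinant 1, clears the lower left block and leaves \<open>b I - A B\<close> on the diagonal;
  multiplying by \<open>?R\<close>, of determinant \<open>b ^ n\<close>, clears the upper right
  block and leaves \<open>b I - B A\<close>.\<close>

lemma power_mult_det_commute:
  fixes A B :: "'a :: idom mat"
  assumes A: "A \<in> carrier_mat m n" and B: "B \<in> carrier_mat n m"
  shows "b ^ n * det (b \<cdot>\<^sub>m 1\<^sub>m m - A * B) = b ^ m * det (b \<cdot>\<^sub>m 1\<^sub>m n - B * A)"
proof -
  let ?M = "four_block_mat (b \<cdot>\<^sub>m 1\<^sub>m m) A B (1\<^sub>m n)"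
  let ?L = "four_block_mat (1\<^sub>m m) (0\<^sub>m m n) (- B) (1\<^sub>m n)"
  let ?R = "four_block_mat (1\<^sub>m m) (- A) (0\<^sub>m n m) (b \<cdot>\<^sub>m 1\<^sub>m n)"
  have M: "?M \<in> carrier_mat (m + n) (m + n)" using A B by auto
  have L: "?L \<in> carrier_mat (m + n) (m + n)" using A B by auto
  have R: "?R \<in> carrier_mat (m + n) (m + n)" using A B by auto
  have "?M * ?L = four_block_mat (b \<cdot>\<^sub>m 1\<^sub>m m * 1\<^sub>m m + A * - B)
      (b \<cdot>\<^sub>m 1\<^sub>m m * 0\<^sub>m m n + A * 1\<^sub>m n) (B * 1\<^sub>m m + 1\<^sub>m n * - B) (B * 0\<^sub>m m n + 1\<^sub>m n * 1\<^sub>m n)"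
    by (rule mult_four_block_mat[of _ m m _ n _ n]) (use A B in auto)
  also have "\<dots> = four_block_mat (b \<cdot>\<^sub>m 1\<^sub>m m - A * B) A (0\<^sub>m n m) (1\<^sub>m n)"
    using A B by (intro cong_four_block_mat eq_matI) (auto simp: scalar_prod_uminus_right)
  finally have left: "?M * ?L = \<dots>" .
  have "?M * ?R = four_block_mat (b \<cdot>\<^sub>m 1\<^sub>m m * 1\<^sub>m m + A * 0\<^sub>m n m)
      (b \<cdot>\<^sub>m 1\<^sub>m m * - A + A * (b \<cdot>\<^sub>m 1\<^sub>m n)) (B * 1\<^sub>m m + 1\<^sub>m n * 0\<^sub>m n m) (B * - A + 1\<^sub>m n * (b \<cdot>\<^sub>m 1\<^sub>m n))"
    by (rule mult_four_block_mat[of _ m m _ n _ n]) (use A B in auto)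
  also have "\<dots> = four_block_mat (b \<cdot>\<^sub>m 1\<^sub>m m) (0\<^sub>m m n) B (b \<cdot>\<^sub>m 1\<^sub>m n - B * A)"
  proof -
    have "b \<cdot>\<^sub>m 1\<^sub>m m * - A = - (b \<cdot>\<^sub>m A)" and "A * (b \<cdot>\<^sub>m 1\<^sub>m n) = b \<cdot>\<^sub>m A"
      using A mult_smult_assoc_mat[of "1\<^sub>m m" m m "- A" n b] mult_smult_distrib[OF A, of "1\<^sub>m n" n b]
      by auto
    then show ?thesis
      using A B by (intro cong_four_block_mat eq_matI) auto
  qed
  finally have right: "?M * ?R = \<dots>" .
  have "det ?M = det (?M * ?L)"
    using det_mult[OF M L] det_four_block_mat_upper_right_zero[of "1\<^sub>m m" m "0\<^sub>m m n" n "- B" "1\<^sub>m n"] B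
    by simp
  also have "\<dots> = det (b \<cdot>\<^sub>m 1\<^sub>m m - A * B)"
    unfolding left by (subst det_four_block_mat_lower_left_zero) (use A B in auto)
  finally have 1: "det ?M = \<dots>" .
  have "det ?M * b ^ n = det (?M * ?R)"
    using det_mult[OF M R] det_four_block_mat_lower_left_zero[of "1\<^sub>m m" m "- A" n "0\<^sub>m n m" "b \<cdot>\<^sub>m 1\<^sub>m n"] A
    by simp
  also have "\<dots> = b ^ m * det (b \<cdot>\<^sub>m 1\<^sub>m n - B * A)"
    unfolding right by (subst det_four_block_mat_upper_right_zero) (use A B in auto)
  finally show ?thesis using 1 by (simp add: mult.commute)
qed

text \<open>Passing to constant polynomials entrywise respects matrix products; this is what allows
  products of lifted matrices to be evaluated at a scalar.\<close>

interpretation const_poly_hom: comm_ring_hom "\<lambda>a :: 'a :: comm_ring_1. [:a:]"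
  by unfold_locales (auto simp: one_pCons)

lemma det_commute:
  fixes A B :: "'a :: idom mat"
  assumes A: "A \<in> carrier_mat m n" and B: "B \<in> carrier_mat n m" and "n \<le> m"
  shows "det (b \<cdot>\<^sub>m 1\<^sub>m m - A * B) = b ^ (m - n) * det (b \<cdot>\<^sub>m 1\<^sub>m n - B * A)"
proof -
  \<comment> \<open>Over \<open>'a[X]\<close> the power of the scalar can be cancelled; evaluating afterwards also covers the scalar \<open>0\<close>.\<close>
  let ?x = "[:0, 1:] :: 'a poly"
  let ?A = "map_mat (\<lambda>a. [:a:]) A" and ?B = "map_mat (\<lambda>a. [:a:]) B"
  let ?p = "det (?x \<cdot>\<^sub>m 1\<^sub>m m - ?A * ?B)" and ?q = "det (?x \<cdot>\<^sub>m 1\<^sub>m n - ?B * ?A)"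
  have "?x ^ n * ?p = ?x ^ m * ?q"
    by (rule power_mult_det_commute) (use A B in auto)
  also have "?x ^ m = ?x ^ n * ?x ^ (m - n)"
    using \<open>n \<le> m\<close> by (simp flip: power_add)
  finally have "?x ^ n * ?p = ?x ^ n * (?x ^ (m - n) * ?q)"
    by (simp only: mult.assoc)
  then have "?p = ?x ^ (m - n) * ?q"
    by simp
  moreover have "poly ?p b = det (b \<cdot>\<^sub>m 1\<^sub>m m - A * B)"
  proof -
    show ?thesis
      by (rule poly_det_cong[of _ m]) (use A B in \<open>auto simp flip: const_poly_hom.mat_hom_mult\<close>)
  qed
  moreover have "poly ?q b = det (b \<cdot>\<^sub>m 1\<^sub>m n - B * A)"
  proof -
    show ?thesis
      by (rule poly_det_cong[of _ n]) (use A B in \<open>auto simp flip: const_poly_hom.mat_hom_mult\<close>)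
  qed
  ultimately show ?thesis by simp
qed

text \<open>For a bipartition given by the predicate \<open>P\<close>, this is diag(x, y) - C. Using
  a predicate on indices instead of a block matrix leaves the enumeration of the vertices
  arbitrary.\<close>

definition bipartite_pencil :: "(nat \<Rightarrow> bool) \<Rightarrow> 'a :: comm_ring_1 mat \<Rightarrow> 'a \<Rightarrow> 'a \<Rightarrow> 'a mat" where
  "bipartite_pencil P C x y = mat (dim_row C) (dim_row C)
     (\<lambda>(i, j). (if i = j then if P i then x else y else 0) - C $$ (i, j))"

text \<open>Multiply the rows and columns outside \<open>P\<close> by \<open>u\<close>: the
  determinant gains \<open>u ^ (2 * n2)\<close>, and the resulting matrix has a common factor
  \<open>u\<close>, which contributes \<open>u ^ (n1 + n2)\<close> on the other side. The quotient
  of the two powers is \<open>u ^ (n1 - n2)\<close>.\<close>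

lemma det_bipartite_pencil:
  fixes C :: "'a :: idom mat"
  assumes C: "C \<in> carrier_mat (n1 + n2) (n1 + n2)"
    and bip: "\<And>i j. i < n1 + n2 \<Longrightarrow> j < n1 + n2 \<Longrightarrow> P i = P j \<Longrightarrow> C $$ (i, j) = 0"
    and n2: "card {i. i < n1 + n2 \<and> \<not> P i} = n2" and "n2 \<le> n1"
  shows "det (bipartite_pencil P C (u * x) y) = u ^ (n1 - n2) * det (bipartite_pencil P C x (u * y))"
proof -
  let ?n = "n1 + n2"
  have scaled: "u ^ (2 * n2) * det (bipartite_pencil P C (u * x) y)
      = u ^ ?n * det (bipartite_pencil P C x (u * y))"
    if C: "C \<in> carrier_mat ?n ?n"
      and bip: "\<And>i j. i < ?n \<Longrightarrow> j < ?n \<Longrightarrow> P i = P j \<Longrightarrow> C $$ (i, j) = 0"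
    for C :: "'b :: idom mat" and u x y
  proof -
    let ?e = "\<lambda>i. if P i then 1 else u"
    have "(\<Prod>i<?n. ?e i) = (\<Prod>i\<in>{i. i < ?n \<and> \<not> P i}. u)"
      by (rule prod.mono_neutral_cong_right) auto
    then have e: "(\<Prod>i<?n. ?e i) = u ^ n2"
      by (simp add: n2)
    \<comment> \<open>Entries of \<open>C\<close> between the classes gain one factor
      \<open>u\<close>, those inside a class vanish, and the diagonal \<open>y\<close> gains two.
      The diagonal \<open>u * x\<close> already has its factor, so one \<open>u\<close> comes out of
      every entry.\<close>
    have "mat ?n ?n (\<lambda>(i, j). ?e i * bipartite_pencil P C (u * x) y $$ (i, j) * ?e j)
        = u \<cdot>\<^sub>m bipartite_pencil P C x (u * y)"
      using C bip by (intro eq_matI) (auto simp: bipartite_pencil_def algebra_simps)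
    moreover have "bipartite_pencil P C (u * x) y \<in> carrier_mat ?n ?n"
      using C by (simp add: bipartite_pencil_def)
    ultimately have "det (u \<cdot>\<^sub>m bipartite_pencil P C x (u * y))
        = u ^ n2 * u ^ n2 * det (bipartite_pencil P C (u * x) y)"
      using det_scale_rows_cols[of "bipartite_pencil P C (u * x) y" ?n ?e ?e] by (simp add: e)
    moreover have "dim_col (bipartite_pencil P C x (u * y)) = ?n"
      using C by (simp add: bipartite_pencil_def)
    ultimately show ?thesis
      by (simp only: det_smult mult_2 power_add)
  qed
  \<comment> \<open>The power of \<open>u\<close> can be cancelled only if \<open>u\<close> is
    nonzero. With an indeterminate in place of \<open>u\<close> this is automatic, and evaluation
    gives the identity for all \<open>u\<close>; for this \<open>scaled\<close> is stated over an
    arbitrary domain.\<close>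
  let ?X = "[:0, 1:] :: 'a poly"
  let ?C = "map_mat (\<lambda>a. [:a:]) C"
  let ?p = "det (bipartite_pencil P ?C (?X * [:x:]) [:y:])"
  let ?q = "det (bipartite_pencil P ?C [:x:] (?X * [:y:]))"
  have "?X ^ (2 * n2) * ?p = ?X ^ ?n * ?q"
    by (rule scaled) (use C bip in auto)
  moreover have "?n = 2 * n2 + (n1 - n2)"
    using \<open>n2 \<le> n1\<close> by simp
  ultimately have "?X ^ (2 * n2) * ?p = ?X ^ (2 * n2) * (?X ^ (n1 - n2) * ?q)"
    by (simp only: power_add mult.assoc)
  then have "?p = ?X ^ (n1 - n2) * ?q"
    by simp
  then have "poly ?p u = u ^ (n1 - n2) * poly ?q u"
    by simp
  moreover have "poly (det (bipartite_pencil P ?C f g)) u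
      = det (bipartite_pencil P C (poly f u) (poly g u))" for f g
    by (rule poly_det_cong[of _ ?n]) (use C in \<open>auto simp: bipartite_pencil_def\<close>)
  ultimately show ?thesis by simp
qed

text \<open>A graph can have fewer edges than vertices, as a star does, and then the exponent is
  negative. In that case \<open>b\<close> is nonzero and can be divided by; otherwise the exponent
  is a natural number and \<open>b = 0\<close> is allowed.\<close>

lemma det_commute_powi:
  fixes A B :: "'a :: field mat"
  assumes A: "A \<in> carrier_mat m n" and B: "B \<in> carrier_mat n m" and "b \<noteq> 0 \<or> n \<le> m"
  shows "det (b \<cdot>\<^sub>m 1\<^sub>m m - A * B) = b powi (int m - int n) * det (b \<cdot>\<^sub>m 1\<^sub>m n - B * A)"
proof (cases "n \<le> m")
  case True
  then show ?thesis
    using det_commute[OF A B] by (simp flip: of_nat_diff)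
next
  case False
  then have "b \<noteq> 0" using assms(3) by simp
  then show ?thesis
    using power_mult_det_commute[OF A B, of b] by (simp add: power_int_diff field_simps)
qed

section \<open>The incidence matrix and its two products with its transpose\<close>

lemma sum_nth_distinct:
  "distinct xs \<Longrightarrow> (\<Sum>k<length xs. f (xs ! k)) = sum f (set xs)"
  by (rule sum.reindex_bij_betw) (simp add: bij_betw_nth)

definition incidence_matrix :: "'a list \<Rightarrow> 'a set list \<Rightarrow> real mat" where
  "incidence_matrix vs es = mat (length vs) (length es) (\<lambda>(i, j). of_bool (vs ! i \<in> es ! j))"

lemma incidence_matrix_carrier [simp]:
  "incidence_matrix vs es \<in> carrier_mat (length vs) (length es)"
  by (simp add: incidence_matrix_def)

lemma simple_graph_finite_edges: "simple_graph G \<Longrightarrow> finite (ugraph_edges G)"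
  unfolding simple_graph_def by (rule finite_subset[of _ "Pow (ugraph_verts G)"]) auto

lemma card_2_Int_distinct:
  assumes "card e = 2" "card f = 2" "e \<noteq> f" "e \<inter> f \<noteq> {}"
  shows "card (e \<inter> f) = 1"
proof -
  have fin: "finite e" "finite f"
    using assms card.infinite by force+
  have "e \<inter> f \<noteq> e"
    using assms fin card_subset_eq[of f e] by auto
  then have "card (e \<inter> f) < card e"
    using fin by (intro psubset_card_mono) auto
  moreover have "card (e \<inter> f) > 0"
    using assms fin by (simp add: card_gt_0_iff)
  ultimately show ?thesis using assms by simp
qed

text \<open>The entry at two edges counts their common endpoints: 2 for equal edges, 1 for distinct
  edges that meet, 0 otherwise.\<close>

lemma transpose_incidence_mult_incidence:
  assumes G: "simple_graph G" and vs: "vertex_enum G vs" and es: "vertex_enum (line_graph G) es"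
  shows "transpose_mat (incidence_matrix vs es) * incidence_matrix vs es
       = adjacency_matrix (line_graph G) es + 2 \<cdot>\<^sub>m 1\<^sub>m (length es)"
proof (rule eq_matI, goal_cases)
  case (1 i j)
  then have ij: "i < length es" "j < length es"
    by (auto simp: adjacency_matrix_def)
  have E: "set es = ugraph_edges G" "distinct es"
    using es by (auto simp: vertex_enum_def line_graph_def)
  have V: "set vs = ugraph_verts G" "distinct vs"
    using vs by (auto simp: vertex_enum_def)
  have edges: "es ! i \<in> ugraph_edges G" "es ! j \<in> ugraph_edges G"
    using ij by (simp_all flip: E(1))
  then have sub: "es ! i \<subseteq> set vs" "es ! j \<subseteq> set vs" "card (es ! i) = 2" "card (es ! j) = 2"
    using G V by (auto simp: simple_graph_def)
  have "(transpose_mat (incidence_matrix vs es) * incidence_matrix vs es) $$ (i, j)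
      = (\<Sum>k<length vs. of_bool (vs ! k \<in> es ! i \<inter> es ! j))"
    using ij by (auto simp: incidence_matrix_def scalar_prod_def lessThan_atLeast0 Collect_conj_eq Int_assoc)
  also have "\<dots> = (\<Sum>v\<in>set vs. of_bool (v \<in> es ! i \<inter> es ! j))"
    by (rule sum_nth_distinct) (rule V(2))
  also have "\<dots> = real (card (es ! i \<inter> es ! j))"
  proof -
    have "set vs \<inter> {v. v \<in> es ! i \<inter> es ! j} = es ! i \<inter> es ! j"
      using sub(1) by blast
    then show ?thesis by (simp add: sum_of_bool_eq)
  qed
  also have "\<dots> = (adjacency_matrix (line_graph G) es + 2 \<cdot>\<^sub>m 1\<^sub>m (length es)) $$ (i, j)"
  proof (cases "i = j")
    case True
    \<comment> \<open>On the diagonal the adjacency matrix tests the singleton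
      \<open>{es ! i}\<close>, which is not an edge of the line graph.\<close>
    have "{es ! i, es ! i} \<notin> ugraph_edges (line_graph G)"
      by (auto simp: line_graph_def doubleton_eq_iff)
    then show ?thesis using True ij sub by (simp add: adjacency_matrix_def)
  next
    case False
    then have neq: "es ! i \<noteq> es ! j"
      using E ij by (simp add: nth_eq_iff_index_eq)
    then have "{es ! i, es ! j} \<in> ugraph_edges (line_graph G) \<longleftrightarrow> es ! i \<inter> es ! j \<noteq> {}"
      using edges by (auto simp: line_graph_def doubleton_eq_iff)
    then show ?thesis
      using False ij card_2_Int_distinct[OF sub(3,4) neq] by (auto simp: adjacency_matrix_def)
  qed
  finally show ?case .
qed (auto simp: adjacency_matrix_def incidence_matrix_def)

text \<open>The entry at two vertices counts the edges containing both: the degree if the vertices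
  coincide, otherwise at most the one edge that joins them.\<close>

lemma incidence_mult_transpose_incidence:
  assumes G: "simple_graph G" and vs: "vertex_enum G vs" and es: "vertex_enum (line_graph G) es"
  shows "incidence_matrix vs es * transpose_mat (incidence_matrix vs es)
       = degree_matrix G vs + adjacency_matrix G vs"
proof (rule eq_matI, goal_cases)
  case (1 i j)
  then have ij: "i < length vs" "j < length vs"
    by (auto simp: adjacency_matrix_def)
  have E: "set es = ugraph_edges G" "distinct es"
    using es by (auto simp: vertex_enum_def line_graph_def)
  let ?S = "{e \<in> ugraph_edges G. vs ! i \<in> e \<and> vs ! j \<in> e}"
  have "(incidence_matrix vs es * transpose_mat (incidence_matrix vs es)) $$ (i, j)
      = (\<Sum>k<length es. of_bool (vs ! i \<in> es ! k \<and> vs ! j \<in> es ! k))"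
    using ij by (auto simp: incidence_matrix_def scalar_prod_def lessThan_atLeast0 Collect_conj_eq Int_assoc)
  also have "\<dots> = (\<Sum>e\<in>set es. of_bool (vs ! i \<in> e \<and> vs ! j \<in> e))"
    by (rule sum_nth_distinct) (rule E(2))
  also have "\<dots> = real (card ?S)"
    using simple_graph_finite_edges[OF G] E by (simp add: Int_def)
  also have "\<dots> = (degree_matrix G vs + adjacency_matrix G vs) $$ (i, j)"
  proof (cases "i = j")
    case True
    have "{vs ! i} \<notin> ugraph_edges G"
      using G by (auto simp: simple_graph_def)
    then show ?thesis
      using True ij by (simp add: adjacency_matrix_def degree_matrix_def vertex_degree_def)
  next
    case False
    then have neq: "vs ! i \<noteq> vs ! j"
      using vs ij by (simp add: vertex_enum_def nth_eq_iff_index_eq)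
    have "e = {vs ! i, vs ! j}" if "e \<in> ?S" for e
      using that G neq by (auto simp: simple_graph_def card_2_iff)
    then have "?S = (if {vs ! i, vs ! j} \<in> ugraph_edges G then {{vs ! i, vs ! j}} else {})"
      by auto
    then show ?thesis
      using False ij by (simp add: adjacency_matrix_def degree_matrix_def)
  qed
  finally show ?case .
qed (auto simp: adjacency_matrix_def incidence_matrix_def degree_matrix_def)

section \<open>Counting edges and degrees in the line graph\<close>

text \<open>Double counting of incidences between \<open>W\<close> and the edges. Taking both vertex
  classes for \<open>W\<close> yields \<open>n1 * r1 = n2 * r2\<close>.\<close>

lemma card_edges_eq_card_times_degree:
  assumes "finite (ugraph_edges G)" "finite W"
    and "\<And>e. e \<in> ugraph_edges G \<Longrightarrow> card (W \<inter> e) = 1"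
    and "\<And>v. v \<in> W \<Longrightarrow> vertex_degree G v = r"
  shows "card (ugraph_edges G) = card W * r"
proof -
  have "(\<Sum>e\<in>ugraph_edges G. card {v \<in> W. v \<in> e}) = r * card W"
    using assms by (intro sum_multicount) (auto simp: vertex_degree_def)
  moreover have "card {v \<in> W. v \<in> e} = 1" if "e \<in> ugraph_edges G" for e
    using assms(3)[OF that] by (simp add: Int_def)
  ultimately show ?thesis by (simp add: mult.commute)
qed

text \<open>The degree counts pairs \<open>{e, f}\<close>; the injection sending \<open>f\<close> to
  \<open>{e, f}\<close> turns this into a count of the neighbours \<open>f\<close>.\<close>

lemma vertex_degree_line_graph_card:
  assumes "e \<in> ugraph_edges G"
  shows "vertex_degree (line_graph G) e = card {f \<in> ugraph_edges G. f \<noteq> e \<and> e \<inter> f \<noteq> {}}"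
    (is "_ = card ?N")
proof -
  have "{x \<in> ugraph_edges (line_graph G). e \<in> x} = (\<lambda>f. {e, f}) ` ?N"
    using assms unfolding line_graph_def by (fastforce simp: insert_commute Int_commute)
  moreover have "inj_on (\<lambda>f. {e, f}) ?N"
    by (auto simp: inj_on_def doubleton_eq_iff)
  ultimately show ?thesis
    by (simp add: vertex_degree_def card_image)
qed

text \<open>Inclusion-exclusion for the edges at \<open>u\<close> and the edges at \<open>v\<close>:
  they share only \<open>{u, v}\<close>, and their union is the neighbourhood of
  \<open>{u, v}\<close> together with \<open>{u, v}\<close> itself. Adding 2 on the left avoids
  truncated subtraction.\<close>

lemma vertex_degree_line_graph:
  assumes "simple_graph G" and e: "{u, v} \<in> ugraph_edges G"
  shows "vertex_degree (line_graph G) {u, v} + 2 = vertex_degree G u + vertex_degree G v"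
proof -
  let ?U = "{f \<in> ugraph_edges G. u \<in> f}" and ?V = "{f \<in> ugraph_edges G. v \<in> f}"
  let ?N = "{f \<in> ugraph_edges G. f \<noteq> {u, v} \<and> {u, v} \<inter> f \<noteq> {}}"
  have fin: "finite (ugraph_edges G)"
    using assms(1) by (rule simple_graph_finite_edges)
  have card2: "card f = 2" if "f \<in> ugraph_edges G" for f
    using assms(1) that by (simp add: simple_graph_def)
  have "u \<noteq> v" using card2[OF e] by auto
  then have "f = {u, v}" if "f \<in> ugraph_edges G" "u \<in> f" "v \<in> f" for f
    using card2[OF that(1)] that(2,3) \<open>u \<noteq> v\<close> by (auto simp: card_2_iff)
  then have int: "?U \<inter> ?V = {{u, v}}"
    using e by blast
  have un: "?U \<union> ?V = insert {u, v} ?N"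
    using e by auto
  have "vertex_degree (line_graph G) {u, v} = card ?N"
    using e by (rule vertex_degree_line_graph_card)
  moreover have "card ?U + card ?V = card ?N + 2"
    using card_Un_Int[of ?U ?V] fin by (simp add: int un)
  ultimately show ?thesis
    by (simp add: vertex_degree_def)
qed

section \<open>The characteristic polynomial of \<open>A_alpha\<close> of the line graph\<close>

text \<open>The degree part is the scalar \<open>\<alpha> * (r - 2)\<close> and the adjacency part
  is the incidence product minus 2, so the scalars add up to \<open>\<alpha> * r - 2\<close>. The
  factor \<open>1 - \<alpha>\<close> is attached to the left matrix so that a plain product remains,
  ready for exchanging the factors.\<close>

lemma A_alpha_line_graph:
  assumes G: "simple_graph G" and vs: "vertex_enum G vs" and es: "vertex_enum (line_graph G) es"
    and deg: "\<And>e. e \<in> ugraph_edges G \<Longrightarrow> vertex_degree (line_graph G) e + 2 = r"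
  shows "A_alpha \<alpha> (line_graph G) es = (\<alpha> * real r - 2) \<cdot>\<^sub>m 1\<^sub>m (length es)
    + ((1 - \<alpha>) \<cdot>\<^sub>m transpose_mat (incidence_matrix vs es)) * incidence_matrix vs es"
proof -
  have d: "real (vertex_degree (line_graph G) (es ! i)) = real r - 2" if "i < length es" for i
  proof -
    have "es ! i \<in> ugraph_edges G"
      using es nth_mem[OF that] by (simp add: vertex_enum_def line_graph_def)
    from deg[OF this] show ?thesis by linarith
  qed
  have "A_alpha \<alpha> (line_graph G) es = (\<alpha> * real r - 2) \<cdot>\<^sub>m 1\<^sub>m (length es)
      + (1 - \<alpha>) \<cdot>\<^sub>m (adjacency_matrix (line_graph G) es + 2 \<cdot>\<^sub>m 1\<^sub>m (length es))"
    by (intro eq_matI) (auto simp: A_alpha_def degree_matrix_def adjacency_matrix_def d, simp_all add: algebra_simps)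
  moreover have "((1 - \<alpha>) \<cdot>\<^sub>m transpose_mat (incidence_matrix vs es)) * incidence_matrix vs es
      = (1 - \<alpha>) \<cdot>\<^sub>m (transpose_mat (incidence_matrix vs es) * incidence_matrix vs es)"
    by (rule mult_smult_assoc_mat[of _ "length es" "length vs" _ "length es"]) simp_all
  ultimately show ?thesis
    by (simp only: transpose_incidence_mult_incidence[OF G vs es])
qed

lemma map_mat_of_real_add:
  assumes "A \<in> carrier_mat nr nc" "B \<in> carrier_mat nr nc"
  shows "map_mat of_real (A + B) = map_mat of_real A + map_mat of_real B"
  using assms by (intro eq_matI) auto

text \<open>Stated over any \<open>real_field\<close>, to serve real and complex arguments at once.
  Here \<open>x\<close> and \<open>y\<close> stand for \<alpha>1 and \<alpha>2, specified without
  division, and \<open>s\<close> and \<open>t\<close> for the two square roots of the formula,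
  specified by algebraic relations in place of a choice of branch.\<close>

lemma charpoly_A_alpha_line_graph:
  fixes z s t b c x y :: "'a :: real_field"
  assumes G: "simple_graph G"
    and V: "ugraph_verts G = V1 \<union> V2" "V1 \<inter> V2 = {}"
    and bip: "\<And>e. e \<in> ugraph_edges G \<Longrightarrow> \<exists>u\<in>V1. \<exists>v\<in>V2. e = {u, v}"
    and deg: "\<And>v. v \<in> V1 \<Longrightarrow> vertex_degree G v = r1" "\<And>v. v \<in> V2 \<Longrightarrow> vertex_degree G v = r2"
    and vs: "vertex_enum G vs" and es: "vertex_enum (line_graph G) es"
    and n: "card V1 = n1" "card V2 = n2" "n2 \<le> n1"
    and c: "c = of_real (1 - \<alpha>)" and b: "b = z - of_real \<alpha> * (of_nat r1 + of_nat r2) + 2"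
    and x: "c * x = b - c * of_nat r1" and y: "c * y = b - c * of_nat r2"
    and s: "s\<^sup>2 = x * y" and t: "s ^ (n1 - n2) * t = x ^ (n1 - n2)"
    and b0: "b \<noteq> 0 \<or> n1 + n2 \<le> length es"
  shows "poly (char_poly (map_mat of_real (A_alpha \<alpha> (line_graph G) es))) z
       = c ^ (n1 + n2) * b powi (int (length es) - int (n1 + n2))
         * poly (char_poly (map_mat of_real (adjacency_matrix G vs))) s * t"
proof -
  let ?h = "map_mat of_real :: real mat \<Rightarrow> 'a mat"
  let ?n = "n1 + n2" and ?m = "length es"
  let ?B = "incidence_matrix vs es"
  let ?C = "?h (adjacency_matrix G vs)"
  let ?P = "\<lambda>i. vs ! i \<in> V1"
  have fin: "finite V1" "finite V2"
    using G V by (auto simp: simple_graph_def)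
  have set_vs: "set vs = V1 \<union> V2" "distinct vs"
    using vs V by (auto simp: vertex_enum_def)
  have len: "length vs = ?n"
    using distinct_card[OF set_vs(2)] card_Un_disjoint[OF fin V(2)] n by (simp add: set_vs(1))
  have B: "?B \<in> carrier_mat ?n ?m"
    using incidence_matrix_carrier[of vs es] by (simp add: len)
  have C: "?C \<in> carrier_mat ?n ?n"
    by (simp add: adjacency_matrix_def len)
  have not_V1: "vs ! i \<in> V2" if "i < ?n" "vs ! i \<notin> V1" for i
    using that nth_mem[of i vs] by (auto simp: set_vs len)
  have card_P: "card {i. i < ?n \<and> \<not> ?P i} = n2"
  proof -
    have "bij_betw (nth vs) {i. i < ?n \<and> \<not> ?P i} V2"
      unfolding bij_betw_def
    proof
      show "inj_on (nth vs) {i. i < ?n \<and> \<not> ?P i}"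
        using set_vs(2) by (auto simp: inj_on_def len nth_eq_iff_index_eq)
      show "nth vs ` {i. i < ?n \<and> \<not> ?P i} = V2"
      proof (intro equalityI subsetI)
        fix v assume v: "v \<in> V2"
        then obtain i where "i < ?n" "v = vs ! i"
          using set_vs(1) by (metis UnI2 in_set_conv_nth len)
        then show "v \<in> nth vs ` {i. i < ?n \<and> \<not> ?P i}"
          using v V(2) by auto
      qed (use not_V1 in auto)
    qed
    then show ?thesis
      using bij_betw_same_card n(2) by blast
  qed
  have C_bip: "?C $$ (i, j) = 0" if ij: "i < ?n" "j < ?n" "?P i = ?P j" for i j
  proof -
    have "{vs ! i, vs ! j} \<notin> ugraph_edges G"
    proof
      assume "{vs ! i, vs ! j} \<in> ugraph_edges G"
      then obtain u v where "u \<in> V1" "v \<in> V2" "{vs ! i, vs ! j} = {u, v}"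
        using bip by blast
      then show False
        using V(2) ij(3) by (auto simp: doubleton_eq_iff)
    qed
    then show ?thesis
      using ij by (simp add: adjacency_matrix_def len)
  qed
  have line_deg: "vertex_degree (line_graph G) e + 2 = r1 + r2" if e: "e \<in> ugraph_edges G" for e
    using bip[OF e] e vertex_degree_line_graph[OF G] deg by force
  let ?BT = "c \<cdot>\<^sub>m ?h (transpose_mat ?B)"
  have hB: "?h ?B \<in> carrier_mat ?n ?m" and hBT: "?BT \<in> carrier_mat ?m ?n"
    using B by auto
  have A\<alpha>: "A_alpha \<alpha> (line_graph G) es = (\<alpha> * real (r1 + r2) - 2) \<cdot>\<^sub>m 1\<^sub>m ?m
      + ((1 - \<alpha>) \<cdot>\<^sub>m transpose_mat ?B) * ?B"
    using G vs es line_deg by (rule A_alpha_line_graph)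
  have A: "?h (A_alpha \<alpha> (line_graph G) es) = (z - b) \<cdot>\<^sub>m 1\<^sub>m ?m + ?BT * ?h ?B"
  proof -
    have "?h (A_alpha \<alpha> (line_graph G) es)
        = ?h ((\<alpha> * real (r1 + r2) - 2) \<cdot>\<^sub>m 1\<^sub>m ?m) + ?h (((1 - \<alpha>) \<cdot>\<^sub>m transpose_mat ?B) * ?B)"
      unfolding A\<alpha>
      by (rule map_mat_of_real_add) (use B in auto)
    \<comment> \<open>The definition of \<open>b\<close> gives
      \<open>z - b = \<alpha> * (r1 + r2) - 2\<close>; hence subtracting from \<open>z I\<close>
      leaves exactly \<open>b I\<close> minus the product.\<close>
    also have "?h ((\<alpha> * real (r1 + r2) - 2) \<cdot>\<^sub>m 1\<^sub>m ?m) = (z - b) \<cdot>\<^sub>m 1\<^sub>m ?m"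
      by (intro eq_matI) (auto simp: b algebra_simps)
    also have "?h (((1 - \<alpha>) \<cdot>\<^sub>m transpose_mat ?B) * ?B) = ?h ((1 - \<alpha>) \<cdot>\<^sub>m transpose_mat ?B) * ?h ?B"
      by (rule of_real_hom.mat_hom_mult) (use B in auto)
    also have "?h ((1 - \<alpha>) \<cdot>\<^sub>m transpose_mat ?B) = ?BT"
      by (intro eq_matI) (auto simp: c)
    finally show ?thesis .
  qed
  have BBT: "?h ?B * ?BT = c \<cdot>\<^sub>m (?h (degree_matrix G vs) + ?C)"
  proof -
    have "?h ?B * ?BT = c \<cdot>\<^sub>m (?h ?B * ?h (transpose_mat ?B))"
      by (rule mult_smult_distrib) (use B in auto)
    also have "?h ?B * ?h (transpose_mat ?B) = ?h (?B * transpose_mat ?B)"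
      by (rule of_real_hom.mat_hom_mult[symmetric]) (use B in auto)
    also have "\<dots> = ?h (degree_matrix G vs) + ?C"
      unfolding incidence_mult_transpose_incidence[OF G vs es]
      by (rule map_mat_of_real_add[of _ ?n ?n]) (auto simp: degree_matrix_def adjacency_matrix_def len)
    finally show ?thesis .
  qed
  have "poly (char_poly (?h (A_alpha \<alpha> (line_graph G) es))) z
      = det (z \<cdot>\<^sub>m 1\<^sub>m ?m - ?h (A_alpha \<alpha> (line_graph G) es))"
    by (rule poly_char_poly_eq_det) (simp add: A_alpha_def adjacency_matrix_def)
  also have "z \<cdot>\<^sub>m 1\<^sub>m ?m - ?h (A_alpha \<alpha> (line_graph G) es) = b \<cdot>\<^sub>m 1\<^sub>m ?m - ?BT * ?h ?B"
    unfolding A using B by (intro eq_matI) (auto simp: algebra_simps)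
  also have "det \<dots> = b powi (int ?m - int ?n) * det (b \<cdot>\<^sub>m 1\<^sub>m ?n - ?h ?B * ?BT)"
    using hBT hB b0 by (rule det_commute_powi)
  \<comment> \<open>The diagonal is \<open>b - c * r1 = c * x\<close> on the first class and
    \<open>b - c * r2 = c * y\<close> on the second, so \<open>c\<close> factors out.\<close>
  also have "b \<cdot>\<^sub>m 1\<^sub>m ?n - ?h ?B * ?BT = c \<cdot>\<^sub>m bipartite_pencil ?P ?C x y"
    unfolding BBT using deg not_V1 x y
    by (intro eq_matI)
      (auto simp: bipartite_pencil_def degree_matrix_def adjacency_matrix_def len algebra_simps)
  also have "det \<dots> = c ^ ?n * det (bipartite_pencil ?P ?C x y)"
    by (simp add: bipartite_pencil_def adjacency_matrix_def len)
  also have "det (bipartite_pencil ?P ?C x y) = det (bipartite_pencil ?P ?C s s) * t"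
  proof -
    \<comment> \<open>Passing through the diagonal \<open>(1, u * v)\<close> requires no division,
      so \<open>x\<close>, \<open>y\<close> and \<open>s\<close> may vanish.\<close>
    have pencil: "det (bipartite_pencil ?P ?C (u * 1) v)
        = u ^ (n1 - n2) * det (bipartite_pencil ?P ?C 1 (u * v))" for u v
      using C C_bip card_P n(3) by (rule det_bipartite_pencil)
    have "det (bipartite_pencil ?P ?C x y) = x ^ (n1 - n2) * det (bipartite_pencil ?P ?C 1 (x * y))"
      using pencil[of x y] by (simp only: mult_1_right)
    also have "\<dots> = s ^ (n1 - n2) * det (bipartite_pencil ?P ?C 1 (s * s)) * t"
      unfolding t[symmetric] s[symmetric] power2_eq_square by (simp only: mult_ac)
    also have "\<dots> = det (bipartite_pencil ?P ?C s s) * t"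
      using pencil[of s s] by (simp only: mult_1_right)
    finally show ?thesis .
  qed
  also have "bipartite_pencil ?P ?C s s = s \<cdot>\<^sub>m 1\<^sub>m ?n - ?C"
    by (intro eq_matI) (auto simp: bipartite_pencil_def adjacency_matrix_def len)
  also have "det \<dots> = poly (char_poly ?C) s"
    using poly_char_poly_eq_det[OF C] by simp
  finally show ?thesis by (simp add: ac_simps)
qed

section \<open>The formula for real and for complex arguments\<close>

theorem theorem6:
  fixes G :: "'a ugraph" and vs :: "'a list" and es :: "'a set list"
    and n1 n2 r1 r2 n :: nat and \<alpha> \<gamma> :: real and \<beta> :: int
  assumes "semiregular_bipartite G n1 n2 r1 r2"
    and "n1 > 0" and "n2 > 0" and "r1 > 0" and "r2 > 0"
    and "n1 \<ge> n2"
    and "n = n1 + n2"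
    and "0 \<le> \<alpha>" and "\<alpha> < 1"
    and "vertex_enum G vs"
    and "vertex_enum (line_graph G) es"
    and "\<beta> = int (n1 * r1) - int n"
    and "\<gamma> = (real (n2 * r2) - real (n1 * r1) + 2 * real n) / 2"
  shows
    "(\<forall>x::real.
        let \<alpha>\<^sub>1 = (x - \<alpha> * real r2 - real r1 + 2) / (1 - \<alpha>);
            \<alpha>\<^sub>2 = (x - \<alpha> * real r1 - real r2 + 2) / (1 - \<alpha>)
        in \<alpha>\<^sub>1 \<ge> 0 \<and> \<alpha>\<^sub>2 > 0 \<longrightarrow>
           charfun (A_alpha \<alpha> (line_graph G) es) x =
             (1 - \<alpha>) powr \<gamma> * (x - \<alpha> * (real r1 + real r2) + 2) powi \<beta>
             * charfun (adjacency_matrix G vs) (sqrt (\<alpha>\<^sub>1 * \<alpha>\<^sub>2))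
             * sqrt ((\<alpha>\<^sub>1 / \<alpha>\<^sub>2) ^ (n1 - n2)))
     \<and>
     (\<forall>z::complex.
        let a = complex_of_real \<alpha>;
            \<alpha>\<^sub>1 = (z - a * of_nat r2 - of_nat r1 + 2) / (1 - a);
            \<alpha>\<^sub>2 = (z - a * of_nat r1 - of_nat r2 + 2) / (1 - a);
            b = z - a * (of_nat r1 + of_nat r2) + 2
        in (\<alpha>\<^sub>2 \<noteq> 0 \<or> n1 = n2) \<and> (b \<noteq> 0 \<or> \<beta> \<ge> 0) \<longrightarrow>
           (\<forall>s t :: complex.
              s\<^sup>2 = \<alpha>\<^sub>1 * \<alpha>\<^sub>2 \<and> t\<^sup>2 = (\<alpha>\<^sub>1 / \<alpha>\<^sub>2) ^ (n1 - n2)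
              \<and> s ^ (n1 - n2) * t = \<alpha>\<^sub>1 ^ (n1 - n2) \<longrightarrow>
              ccharfun (A_alpha \<alpha> (line_graph G) es) z =
                complex_of_real ((1 - \<alpha>) powr \<gamma>) * b powi \<beta>
                * ccharfun (adjacency_matrix G vs) s * t))"
proof -
  obtain V1 V2 where G: "simple_graph G" and V: "ugraph_verts G = V1 \<union> V2" "V1 \<inter> V2 = {}"
    and bip: "\<And>e. e \<in> ugraph_edges G \<Longrightarrow> \<exists>u\<in>V1. \<exists>v\<in>V2. e = {u, v}"
    and n12: "card V1 = n1" "card V2 = n2"
    and deg: "\<And>v. v \<in> V1 \<Longrightarrow> vertex_degree G v = r1" "\<And>v. v \<in> V2 \<Longrightarrow> vertex_degree G v = r2"
    using assms(1) unfolding semiregular_bipartite_def by auto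
  have fin: "finite (ugraph_edges G)" "finite V1" "finite V2"
    using simple_graph_finite_edges[OF G] G V by (auto simp: simple_graph_def)
  have int_edge: "card (V1 \<inter> e) = 1 \<and> card (V2 \<inter> e) = 1" if e: "e \<in> ugraph_edges G" for e
  proof -
    obtain u v where uv: "u \<in> V1" "v \<in> V2" "e = {u, v}"
      using bip[OF e] by blast
    then have "V1 \<inter> e = {u}" "V2 \<inter> e = {v}"
      using V(2) by auto
    then show ?thesis by simp
  qed
  have "length es = card (ugraph_edges G)"
    using assms(11) distinct_card[of es] by (auto simp: vertex_enum_def line_graph_def)
  then have m: "length es = n1 * r1" "n1 * r1 = n2 * r2"
    using card_edges_eq_card_times_degree[of G V1 r1] card_edges_eq_card_times_degree[of G V2 r2]
      fin int_edge deg n12 by auto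
  have \<beta>: "int (length es) - int (n1 + n2) = \<beta>"
    using m assms(7,12) by simp
  \<comment> \<open>Since \<open>n1 * r1 = n2 * r2\<close>, the exponent is the number of vertices
    and \<open>powr\<close> becomes an ordinary power.\<close>
  have "\<gamma> = real (n1 + n2)"
    unfolding assms(7,13) m(2) by simp
  then have pw: "(1 - \<alpha>) powr \<gamma> = (1 - \<alpha>) ^ (n1 + n2)"
    using assms(9) by (simp only: powr_realpow)
  note main = charpoly_A_alpha_line_graph[OF G V bip deg assms(10,11) n12 assms(6) refl refl, of \<alpha>,
      unfolded \<beta>]
  have real: "charfun (A_alpha \<alpha> (line_graph G) es) x
      = (1 - \<alpha>) powr \<gamma> * (x - \<alpha> * (real r1 + real r2) + 2) powi \<beta>
        * charfun (adjacency_matrix G vs) (sqrt (\<alpha>1 * \<alpha>2)) * sqrt ((\<alpha>1 / \<alpha>2) ^ (n1 - n2))"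
    if \<alpha>1: "\<alpha>1 = (x - \<alpha> * real r2 - real r1 + 2) / (1 - \<alpha>)"
      and \<alpha>2: "\<alpha>2 = (x - \<alpha> * real r1 - real r2 + 2) / (1 - \<alpha>)"
      and pos: "\<alpha>1 \<ge> 0" "\<alpha>2 > 0" for x \<alpha>1 \<alpha>2 :: real
  proof -
    let ?b = "x - \<alpha> * (real r1 + real r2) + 2"
    have 1: "(1 - \<alpha>) * \<alpha>1 = ?b - (1 - \<alpha>) * real r1" and 2: "(1 - \<alpha>) * \<alpha>2 = ?b - (1 - \<alpha>) * real r2"
      using assms(9) by (simp_all add: \<alpha>1 \<alpha>2 field_simps)
    \<comment> \<open>These make
      \<open>?b = (1 - \<alpha>) * \<alpha>1 + (1 - \<alpha>) * r1\<close> positive, so a negative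
      exponent does no harm.\<close>
    have "0 \<le> (1 - \<alpha>) * \<alpha>1" "0 < (1 - \<alpha>) * real r1"
      using assms(4,9) pos by simp_all
    then have "?b \<noteq> 0"
      using 1 by linarith
    moreover have "sqrt (\<alpha>1 * \<alpha>2) ^ (n1 - n2) * sqrt ((\<alpha>1 / \<alpha>2) ^ (n1 - n2)) = \<alpha>1 ^ (n1 - n2)"
    proof -
      \<comment> \<open>The product is the root of the square of \<alpha>1, which equals \<alpha>1
        by its sign; \<alpha>2 cancels because it is positive.\<close>
      have "sqrt (\<alpha>1 * \<alpha>2) * sqrt (\<alpha>1 / \<alpha>2) = \<alpha>1"
        using pos by (simp flip: real_sqrt_mult power2_eq_square)
      then show ?thesis
        by (simp only: real_sqrt_power flip: power_mult_distrib)
    qed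
    moreover have "(sqrt (\<alpha>1 * \<alpha>2))\<^sup>2 = \<alpha>1 * \<alpha>2"
      using pos by simp
    moreover have "map_mat of_real M = M" for M :: "real mat"
      by (intro eq_matI) auto
    ultimately show ?thesis
      using main[of \<alpha>1 x \<alpha>2] 1 2 by (simp add: pw)
  qed
  \<comment> \<open>A complex root is determined only up to sign. The relation between
    \<open>s\<close> and \<open>t\<close> couples the two signs and is what the general lemma asks
    of \<open>t\<close>.\<close>
  have complex: "ccharfun (A_alpha \<alpha> (line_graph G) es) z
      = complex_of_real ((1 - \<alpha>) powr \<gamma>) * b powi \<beta> * ccharfun (adjacency_matrix G vs) s * t"
    if \<alpha>1: "\<alpha>1 = (z - complex_of_real \<alpha> * of_nat r2 - of_nat r1 + 2) / (1 - complex_of_real \<alpha>)"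
      and \<alpha>2: "\<alpha>2 = (z - complex_of_real \<alpha> * of_nat r1 - of_nat r2 + 2) / (1 - complex_of_real \<alpha>)"
      and b: "b = z - complex_of_real \<alpha> * (of_nat r1 + of_nat r2) + 2"
      and b0: "b \<noteq> 0 \<or> \<beta> \<ge> 0"
      and s: "s\<^sup>2 = \<alpha>1 * \<alpha>2" and t: "s ^ (n1 - n2) * t = \<alpha>1 ^ (n1 - n2)"
    for z \<alpha>1 \<alpha>2 b s t :: complex
  proof -
    have "1 - complex_of_real \<alpha> \<noteq> 0"
      using assms(9) of_real_eq_0_iff[of "1 - \<alpha>", where 'a = complex] by simp
    then have 1: "of_real (1 - \<alpha>) * \<alpha>1 = b - of_real (1 - \<alpha>) * of_nat r1"
      and 2: "of_real (1 - \<alpha>) * \<alpha>2 = b - of_real (1 - \<alpha>) * of_nat r2"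
      by (simp_all add: \<alpha>1 \<alpha>2 b field_simps)
    \<comment> \<open>As \<beta> is the number of edges minus the number of vertices,
      \<open>\<beta> \<ge> 0\<close> says that there are at least as many edges as vertices.\<close>
    have "b \<noteq> 0 \<or> n1 + n2 \<le> length es"
      using b0 \<beta> by linarith
    then show ?thesis
      using main[of \<alpha>1 z \<alpha>2 s t] 1 2 s t by (simp add: b pw)
  qed
  show ?thesis
    unfolding Let_def using real[OF refl refl] complex[OF refl refl refl] by blast
qed

end
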